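(* Let $K$ be a compact Hausdorff space. If $K$ is a continuous open image of the Sorgenfrey line, i.e. if there exists a continuous open surjection $f:\mathbb{S}\to K$, then $K$ is metrizable.
   Context: The Sorgenfrey line $\mathbb{S}$ is the set $\mathbb{R}$ with the topology $\tau_{\mathbb{S}}$ generated by the half-open intervals $\{[a,b): a,b\in\mathbb{R}\}$. A continuous map is called open if the image of every open set under it is open. *)

theory Defs
  imports "HOL-Analysis.Analysis"
begin

definition sorgenfrey_line :: "real topology" where
  "sorgenfrey_line = topology_generated_by {{a..<b} | a b. True}"

end

theory Submission
  imports Defs
begin

text \<open>By compactness, \<open>f\<close> maps some ray \<open>{c..}\<close> onto \<open>K\<close>; let \<open>m y\<close> be the least point of
  \<open>{c..}\<close> over \<open>y\<close>. As \<open>f\<close> is open, the sets \<open>{y. m y < a}\<close> are open, and as \<open>f\<close> is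
  continuous, \<open>y\<close> tends to \<open>p\<close> whenever \<open>m y\<close> tends to \<open>m p\<close> from the right. Call \<open>p\<close> bad
  if some \<open>q \<noteq> p\<close> is a cluster point of \<open>y\<close> as \<open>m y\<close> increases to \<open>m p\<close>; then \<open>m q > m p\<close>. For fixed \<open>r\<close>,
  the values \<open>m p\<close> of those bad \<open>p\<close> with \<open>m p < r \<le> m q\<close> for such a \<open>q\<close> have no accumulation
  from the right: bad points close to \<open>p\<close> on the right have their cluster points \<open>q\<close> in a given closed
  neighbourhood of \<open>p\<close>, which can be chosen inside \<open>{y. m y < r}\<close>. Hence there are only countably
  many bad points. Their singletons and the preimages under \<open>m\<close> of rational intervals form a
  countable network, and a compact Hausdorff space with a countable network is metrizable.\<close>

section \<open>Two countability tools: networks, and values with a gap to their right\<close>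

definition network :: "'a topology \<Rightarrow> 'a set set \<Rightarrow> bool" where
  "network X \<N> \<longleftrightarrow> (\<forall>U x. openin X U \<longrightarrow> x \<in> U \<longrightarrow> (\<exists>N\<in>\<N>. x \<in> N \<and> N \<subseteq> U))"

text \<open>For each of the countably many pairs of network members with some continuous function
  below 1/3 on the first and above 2/3 on the second, choose one such function. The chosen functions
  separate points, so by compactness they embed \<open>X\<close> into a countable power of the
  reals.\<close>

lemma compact_Hausdorff_countable_network_imp_metrizable:
  assumes "compact_space X" and "Hausdorff_space X" and "countable \<N>" and "network X \<N>"
  shows "metrizable_space X"
proof -
  define sep where "sep \<equiv> \<lambda>P (h::'a\<Rightarrow>real). continuous_map X euclideanreal h \<and>
    h ` fst P \<subseteq> {..<1/3} \<and> h ` snd P \<subseteq> {2/3<..}"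
  define I where "I = {P \<in> \<N> \<times> \<N>. \<exists>h. sep P h}"
  define g where "g = (\<lambda>P. SOME h. sep P h)"
  have g: "sep P (g P)" if "P \<in> I" for P
    using that someI_ex[of "sep P"] unfolding I_def g_def by blast
  have "countable I"
    unfolding I_def using assms(3) by simp
  let ?Y = "product_topology (\<lambda>_. euclideanreal) I"
  define F where "F = (\<lambda>x. \<lambda>P\<in>I. g P x)"
  have cF: "continuous_map X ?Y F"
    unfolding continuous_map_componentwise F_def using g by (auto simp: sep_def)
  have crs: "completely_regular_space X"
    using assms compact_Hausdorff_or_regular_imp_normal_space normal_imp_completely_regular_space
    by blast
  have "inj_on F (topspace X)"
  proof (rule inj_onI, rule ccontr)
    fix x y assume xy: "x \<in> topspace X" "y \<in> topspace X" "F x = F y" "x \<noteq> y"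
    have "closedin X {y}"
      by (rule closedin_Hausdorff_singleton[OF assms(2) xy(2)])
    then have "\<exists>h. continuous_map X euclideanreal h \<and> h x = 0 \<and> h ` {y} \<subseteq> {1}"
      using crs[unfolded completely_regular_space_alt, rule_format, of "{y}" x] xy by simp
    then obtain h where h: "continuous_map X euclideanreal h" "h x = 0" "h y = 1"
      by auto
    have pre: "openin X {z \<in> topspace X. h z \<in> T}" if "open T" for T
      by (rule openin_continuous_map_preimage[OF h(1)]) (use that in simp)
    have net: "\<exists>N\<in>\<N>. z \<in> N \<and> N \<subseteq> U" if "openin X U" "z \<in> U" for U z
      using assms(4) that unfolding network_def by simp
    have "x \<in> {z \<in> topspace X. h z \<in> {..<1/3}}"
      using h xy by simp
    from net[OF pre this] obtain M where M: "M \<in> \<N>" "x \<in> M" "M \<subseteq> {z \<in> topspace X. h z \<in> {..<1/3}}"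
      by auto
    have "y \<in> {z \<in> topspace X. h z \<in> {2/3<..}}"
      using h xy by simp
    from net[OF pre this] obtain N where N: "N \<in> \<N>" "y \<in> N" "N \<subseteq> {z \<in> topspace X. h z \<in> {2/3<..}}"
      by auto
    \<comment> \<open>\<open>h\<close> only witnesses that the pair is in \<open>I\<close>. The
      chosen \<open>g (M, N)\<close> may be another function, but it separates \<open>x\<close> from
      \<open>y\<close> as well.\<close>
    have "sep (M, N) h"
      unfolding sep_def using h(1) M(3) N(3) by (auto simp del: less_divide_eq_numeral1 divide_less_eq_numeral1)
    with M N have P: "(M, N) \<in> I"
      unfolding I_def by auto
    from g[OF P] M N have "g (M, N) x < 1/3" "g (M, N) y > 2/3"
      unfolding sep_def by auto
    moreover have "g (M, N) x = g (M, N) y"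
      using fun_cong[OF xy(3), of "(M, N)"] P by (simp add: F_def)
    ultimately show False by simp
  qed
  moreover have "Hausdorff_space ?Y"
    by (simp add: Hausdorff_space_product_topology)
  ultimately have "embedding_map X ?Y F"
    using continuous_imp_embedding_map cF assms(1) by blast
  then have "X homeomorphic_space subtopology ?Y (F ` topspace X)"
    by (rule embedding_map_imp_homeomorphic_space)
  moreover have "metrizable_space ?Y"
    unfolding metrizable_space_product_topology
    using \<open>countable I\<close> by (auto simp: metrizable_space_euclidean intro: countable_subset)
  ultimately show ?thesis
    using homeomorphic_metrizable_space metrizable_space_subtopology by blast
qed

text \<open>Each \<open>m x\<close> has a gap to its right with no value from \<open>A\<close>. A
  rational picked in that gap determines \<open>m x\<close>, hence \<open>x\<close>.\<close>

lemma countable_right_isolated: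
  fixes m :: "'a \<Rightarrow> real"
  assumes "inj_on m A"
    and "\<And>x. x \<in> A \<Longrightarrow> \<exists>e>0. \<forall>y\<in>A. \<not> (m x < m y \<and> m y < m x + e)"
  shows "countable A"
proof -
  have "\<exists>q::rat. m x < of_rat q \<and> (\<forall>y\<in>A. m x < m y \<longrightarrow> of_rat q < m y)" if "x \<in> A" for x
  proof -
    obtain e where e: "e > 0" "\<forall>y\<in>A. \<not> (m x < m y \<and> m y < m x + e)"
      using assms(2) \<open>x \<in> A\<close> by blast
    obtain q where "m x < of_rat q" "of_rat q < m x + e"
      using of_rat_dense[of "m x" "m x + e"] e(1) by auto
    with e(2) show ?thesis by (metis not_less order_less_le_trans)
  qed
  then obtain \<rho> :: "'a \<Rightarrow> rat" where \<rho>: "\<And>x. x \<in> A \<Longrightarrow> m x < of_rat (\<rho> x)"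
    "\<And>x y. x \<in> A \<Longrightarrow> y \<in> A \<Longrightarrow> m x < m y \<Longrightarrow> of_rat (\<rho> x) < m y"
    by metis
  have "inj_on \<rho> A"
  proof (rule inj_onI)
    fix x y assume "x \<in> A" "y \<in> A" "\<rho> x = \<rho> y"
    \<comment> \<open>If \<open>m x < m y\<close>, then \<rho> of \<open>x\<close> is below
      \<open>m y\<close>, which is below \<rho> of \<open>y\<close>.\<close>
    then have "m x = m y"
      using \<rho> by (metis less_asym linorder_neqE_linordered_idom)
    then show "x = y"
      using assms(1) \<open>x \<in> A\<close> \<open>y \<in> A\<close> by (auto dest: inj_onD)
  qed
  then show ?thesis
    by (rule countableI')
qed

section \<open>Compact spaces coded by reals with a right-continuous decoding\<close>

locale sorgenfrey_section =
  fixes K :: "'a topology" and m :: "'a \<Rightarrow> real"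
  assumes compact: "compact_space K" and Hausdorff: "Hausdorff_space K"
    and openin_initial: "\<And>a. openin K {y \<in> topspace K. m y < a}"
    and right_continuous: "\<And>U p. openin K U \<Longrightarrow> p \<in> U \<Longrightarrow>
      \<exists>e>0. \<forall>y\<in>topspace K. m p \<le> m y \<and> m y < m p + e \<longrightarrow> y \<in> U"
begin

text \<open>If \<open>m q = m p\<close>, then \<open>right_continuous\<close> puts \<open>q\<close>
  into every open set around \<open>p\<close>.\<close>

lemma inj_on_section: "inj_on m (topspace K)"
proof (rule inj_onI, rule ccontr)
  fix p q assume pq: "p \<in> topspace K" "q \<in> topspace K" "m p = m q" "p \<noteq> q"
  then obtain U V where "openin K U" "openin K V" "p \<in> U" "q \<in> V" "disjnt U V"
    using Hausdorff unfolding Hausdorff_space_def by blast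
  then show False
    using right_continuous[of U p] pq by (force simp: disjnt_iff)
qed

definition left_near :: "real \<Rightarrow> 'a \<Rightarrow> 'a set" where
  "left_near e p = {y \<in> topspace K. m p - e < m y \<and> m y < m p}"

definition left_cluster :: "'a \<Rightarrow> 'a set" where
  "left_cluster p = (\<Inter>e\<in>{0<..}. K closure_of left_near e p)"

text \<open>The threshold \<open>r\<close> makes the points with value below \<open>r\<close> an
  open neighbourhood of \<open>p\<close> that misses the cluster point \<open>q\<close>.\<close>

definition bad :: "real \<Rightarrow> 'a set" where
  "bad r = {p \<in> topspace K. m p < r \<and> (\<exists>q\<in>left_cluster p. r \<le> m q)}"

lemma left_cluster_subset: "left_cluster p \<subseteq> topspace K"
  unfolding left_cluster_def using closure_of_subset_topspace
  by (metis INF_lower2 greaterThan_iff zero_less_one)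

lemma countable_bad: "countable (bad r)"
proof (rule countable_right_isolated)
  show "inj_on m (bad r)"
    using inj_on_section by (rule inj_on_subset) (auto simp: bad_def)
  fix p assume p: "p \<in> bad r"
  have "neighbourhood_base_of (closedin K) K"
    using compact Hausdorff compact_Hausdorff_imp_regular_space neighbourhood_base_of_closedin
    by blast
  then have nb: "\<exists>U C. openin K U \<and> closedin K C \<and> p \<in> U \<and> U \<subseteq> C \<and> C \<subseteq> W"
    if "openin K W" "p \<in> W" for W
    using that unfolding neighbourhood_base_of by simp
  have "p \<in> {y \<in> topspace K. m y < r}"
    using p by (auto simp: bad_def)
  from nb[OF openin_initial this] obtain U C where UC: "openin K U" "closedin K C" "p \<in> U"
    "U \<subseteq> C" "C \<subseteq> {y \<in> topspace K. m y < r}"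
    by (elim exE conjE)
  obtain e where e: "e > 0" "\<forall>y\<in>topspace K. m p \<le> m y \<and> m y < m p + e \<longrightarrow> y \<in> U"
    using right_continuous UC by blast
  have "\<not> (m p < m p' \<and> m p' < m p + e)" if p': "p' \<in> bad r" for p'
  proof
    assume less: "m p < m p' \<and> m p' < m p + e"
    obtain q where q: "q \<in> left_cluster p'" "r \<le> m q"
      using p' by (auto simp: bad_def)
    \<comment> \<open>With this radius the values lie strictly between \<open>m p\<close> and
      \<open>m p'\<close>, hence within \<open>e\<close> to the right of \<open>m p\<close>. As
      \<open>C\<close> is closed, it also catches the cluster point \<open>q\<close>, although
      \<open>m\<close> stays below \<open>r\<close> on \<open>C\<close>.\<close>
    have "left_near (m p' - m p) p' \<subseteq> C"
      using e UC less by (force simp: left_near_def)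
    then have "K closure_of left_near (m p' - m p) p' \<subseteq> C"
      using UC(2) by (rule closure_of_minimal)
    moreover have "q \<in> K closure_of left_near (m p' - m p) p'"
      using q less by (auto simp: left_cluster_def)
    ultimately show False
      using UC q by auto
  qed
  then show "\<exists>e>0. \<forall>y\<in>bad r. \<not> (m p < m y \<and> m y < m p + e)"
    using e(1) by blast
qed

text \<open>Otherwise, for \<open>a\<close> between \<open>m q\<close> and \<open>m p\<close>, the
  points with value below \<open>a\<close> form a neighbourhood of \<open>q\<close> that misses
  \<open>left_near (m p - a) p\<close>.\<close>

lemma left_cluster_ge:
  assumes "q \<in> left_cluster p"
  shows "m p \<le> m q"
proof (rule ccontr)
  assume "\<not> m p \<le> m q"
  then obtain a where a: "m q < a" "a < m p"
    using dense not_le by blast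
  have "q \<in> K closure_of left_near (m p - a) p"
    using assms a by (auto simp: left_cluster_def)
  then have "\<forall>T. q \<in> T \<and> openin K T \<longrightarrow> (\<exists>y. y \<in> left_near (m p - a) p \<and> y \<in> T)"
    unfolding in_closure_of by (rule conjunct2)
  then obtain y where "y \<in> left_near (m p - a) p" "y \<in> {y \<in> topspace K. m y < a}"
    using a(1) openin_initial[of a] subsetD[OF left_cluster_subset assms] by (smt (verit) mem_Collect_eq)
  then show False
    by (auto simp: left_near_def)
qed

text \<open>If every \<open>left_near e p\<close> leaves \<open>U\<close>, compactness yields a left
  cluster point \<open>q\<close> outside \<open>U\<close>. Then \<open>m p < m q\<close>, and a
  rational \<open>r\<close> in between makes \<open>p\<close> a member of
  \<open>bad r\<close>.\<close>

lemma left_continuous: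
  assumes "openin K U" and "p \<in> U" and good: "\<And>r. r \<in> \<rat> \<Longrightarrow> p \<notin> bad r"
  shows "\<exists>e>0. left_near e p \<subseteq> U"
proof (rule ccontr)
  assume contra: "\<not> (\<exists>e>0. left_near e p \<subseteq> U)"
  have p: "p \<in> topspace K"
    using assms openin_subset by blast
  define C where "C = (\<lambda>n. K closure_of left_near (1 / real (Suc n)) p \<inter> (topspace K - U))"
  have mono: "left_near d p \<subseteq> left_near e p" if "d \<le> e" for d e
    using that by (auto simp: left_near_def)
  have "(\<Inter>n. C n) \<noteq> {}"
  proof (rule compact_space_imp_nest[OF compact])
    show "closedin K (C n)" for n
      using assms(1) unfolding C_def
      by (intro closedin_Int closedin_closure_of closedin_diff closedin_topspace)
    show "C n \<noteq> {}" for n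
    proof -
      have "\<not> left_near (1 / real (Suc n)) p \<subseteq> U"
        using contra by auto
      moreover have "left_near (1 / real (Suc n)) p \<subseteq> K closure_of left_near (1 / real (Suc n)) p"
        by (rule closure_of_subset) (auto simp: left_near_def)
      ultimately show ?thesis
        unfolding C_def by (force simp: left_near_def)
    qed
    show "decseq C"
      unfolding decseq_def C_def
    proof (intro allI impI Int_mono closure_of_mono mono order_refl)
      fix i j :: nat assume "i \<le> j"
      then show "1 / real (Suc j) \<le> 1 / real (Suc i)" by (simp add: field_simps)
    qed
  qed
  then obtain q where q: "\<And>n. q \<in> C n" by blast
  have "q \<in> left_cluster p"
    unfolding left_cluster_def
  proof
    fix e :: real assume "e \<in> {0<..}"
    then obtain n where "1 / real (Suc n) < e"
      using nat_approx_posE by (metis greaterThan_iff)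
    then have "left_near (1 / real (Suc n)) p \<subseteq> left_near e p"
      by (intro mono) simp
    then show "q \<in> K closure_of left_near e p"
      using q[of n] closure_of_mono unfolding C_def by blast
  qed
  moreover have "q \<noteq> p"
    using q[of 0] assms(2) by (auto simp: C_def)
  ultimately have "m p < m q"
    using left_cluster_ge inj_on_section p left_cluster_subset
    by (metis inj_onD order_le_less subsetD)
  then obtain r where "r \<in> \<rat>" "m p < r" "r < m q"
    using Rats_dense_in_real by blast
  then have "p \<in> bad r"
    using p \<open>q \<in> left_cluster p\<close> by (auto simp: bad_def intro: less_imp_le)
  with good \<open>r \<in> \<rat>\<close> show False by blast
qed

lemma metrizable: "metrizable_space K"
proof (rule compact_Hausdorff_countable_network_imp_metrizable[OF compact Hausdorff])
  define B where "B = (\<Union>r\<in>\<rat>. bad r)"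
  define \<N> where "\<N> = (\<lambda>(a, b). {y \<in> topspace K. a < m y \<and> m y < b}) ` (\<rat> \<times> \<rat>) \<union> (\<lambda>p. {p}) ` B"
  have "countable B"
    unfolding B_def using countable_bad countable_rat by blast
  then show "countable \<N>"
    unfolding \<N>_def using countable_rat by auto
  show "network K \<N>"
    unfolding network_def
  proof (intro allI impI)
    fix U p assume U: "openin K U" "p \<in> U"
    then have p: "p \<in> topspace K"
      using openin_subset by blast
    show "\<exists>N\<in>\<N>. p \<in> N \<and> N \<subseteq> U"
    proof (cases "p \<in> B")
      case True
      then show ?thesis
        using U unfolding \<N>_def by blast
    next
      case False
      then obtain d where d: "d > 0" "left_near d p \<subseteq> U"
        using left_continuous[OF U] unfolding B_def by blast
      obtain e where e: "e > 0" "\<forall>y\<in>topspace K. m p \<le> m y \<and> m y < m p + e \<longrightarrow> y \<in> U"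
        using right_continuous U by blast
      obtain a b where ab: "a \<in> \<rat>" "m p - d < a" "a < m p" "b \<in> \<rat>" "m p < b" "b < m p + e"
        using Rats_dense_in_real[of "m p - d" "m p"] Rats_dense_in_real[of "m p" "m p + e"] d e
        by auto
      \<comment> \<open>Values from \<open>m p\<close> upwards are handled by \<open>e\<close>,
        smaller ones by \<open>d\<close>.\<close>
      have "{y \<in> topspace K. a < m y \<and> m y < b} \<subseteq> U"
      proof clarify
        fix y assume y: "y \<in> topspace K" "a < m y" "m y < b"
        show "y \<in> U"
        proof (cases "m p \<le> m y")
          case True
          then show ?thesis using e ab y by auto
        next
          case False
          then have "y \<in> left_near d p" using ab y by (auto simp: left_near_def)
          then show ?thesis using d by blast
        qed
      qed
      moreover have "{y \<in> topspace K. a < m y \<and> m y < b} \<in> \<N>"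
        using ab unfolding \<N>_def by blast
      moreover have "p \<in> {y \<in> topspace K. a < m y \<and> m y < b}"
        using p ab by simp
      ultimately show ?thesis
        by (intro bexI conjI)
    qed
  qed
qed

end

section \<open>The Sorgenfrey topology and least preimages\<close>

lemma topspace_sorgenfrey_line [simp]: "topspace sorgenfrey_line = UNIV"
proof -
  have "x \<in> \<Union>{{a..<b} | a b. True}" for x :: real
    by (rule UnionI[of "{x..<x+1}"]) auto
  then show ?thesis
    unfolding sorgenfrey_line_def topology_generated_by_topspace by blast
qed

lemma openin_sorgenfrey_line_Ico [simp]: "openin sorgenfrey_line {a..<b}"
  unfolding sorgenfrey_line_def by (rule topology_generated_by_Basis) blast

lemma openin_sorgenfrey_line_Ici [simp]: "openin sorgenfrey_line {a..}"
proof -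
  have "{a..} = (\<Union>b. {a..<b})"
    by (auto intro: gt_ex)
  then show ?thesis
    by (metis openin_Union imageE openin_sorgenfrey_line_Ico)
qed

lemma openin_sorgenfrey_lineD:
  assumes "openin sorgenfrey_line U" and "x \<in> U"
  shows "\<exists>e>0. {x..<x+e} \<subseteq> U"
proof -
  have "generate_topology_on {{a..<b} | a b. True} U"
    using assms(1) unfolding sorgenfrey_line_def by (rule openin_topology_generated_by)
  then show ?thesis
    using assms(2)
  proof (induction arbitrary: x)
    case Empty
    then show ?case by simp
  next
    case (Int U V)
    then obtain d e where "d > 0" "{x..<x+d} \<subseteq> U" "e > 0" "{x..<x+e} \<subseteq> V" by blast
    then show ?case
      by (intro exI[of _ "min d e"]) (auto simp: subset_iff)
  next
    case (UN \<U>)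
    then show ?case by (meson Union_iff Union_upper order_trans)
  next
    case (Basis S)
    then obtain a b where S: "S = {a..<b}" by blast
    with Basis show ?case
      by (intro exI[of _ "b - x"]) auto
  qed
qed

text \<open>The images of the rays form an open cover and increase as \<open>c\<close> decreases, so
  a finite subcover lies inside a single image.\<close>

lemma compact_open_image_of_ray:
  assumes "compact_space K" and "open_map sorgenfrey_line K f" and "range f = topspace K"
  obtains c where "f ` {c..} = topspace K"
proof -
  let ?\<U> = "range (\<lambda>c. f ` {c..})"
  have "\<forall>U\<in>?\<U>. openin K U"
    using assms(2) by (auto simp: open_map_def)
  moreover have "topspace K \<subseteq> \<Union>?\<U>"
    using assms(3) by fastforce
  ultimately obtain \<F> where \<F>: "finite \<F>" "\<F> \<subseteq> ?\<U>" "topspace K \<subseteq> \<Union>\<F>"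
    using assms(1) unfolding compact_space_alt by meson
  then obtain C where C: "finite C" "\<F> = (\<lambda>c. f ` {c..}) ` C"
    by (meson finite_subset_image)
  \<comment> \<open>A lower bound instead of the minimum spares a case for empty
    \<open>C\<close>.\<close>
  obtain b where "\<And>c. c \<in> C \<Longrightarrow> b \<le> c"
    using bdd_below_finite[OF C(1)] unfolding bdd_below_def by blast
  then have "f ` {c..} \<subseteq> f ` {b..}" if "c \<in> C" for c
    using that by (intro image_mono) auto
  then have "topspace K \<subseteq> f ` {b..}"
    using \<F>(3) C(2) by blast
  then show ?thesis
    using that assms(3) by blast
qed

text \<open>The infimum of the fibre within the ray is attained: otherwise \<open>f\<close> avoids
  \<open>y\<close> on a half-open interval starting there. That interval extends to the right, just
  where the fibre must come close to its infimum.\<close>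

lemma least_in_fibre:
  assumes cont: "continuous_map sorgenfrey_line K f" and "Hausdorff_space K"
    and y: "y \<in> f ` {c..}"
  shows "\<exists>t\<ge>c. f t = y \<and> (\<forall>s\<ge>c. f s = y \<longrightarrow> t \<le> s)"
proof -
  define A where "A = {t. c \<le> t \<and> f t = y}"
  have A: "A \<noteq> {}" "bdd_below A"
    using y by (auto simp: A_def bdd_below_def)
  have lower: "Inf A \<le> s" if "s \<in> A" for s
    using A(2) that by (rule cInf_lower[rotated])
  have "c \<le> Inf A"
    using A(1) by (rule cInf_greatest) (auto simp: A_def)
  moreover have "f (Inf A) = y"
  proof (rule ccontr)
    assume ne: "f (Inf A) \<noteq> y"
    have range: "f x \<in> topspace K" for x
      using continuous_map_image_subset_topspace[OF cont] by auto
    then have "openin K (topspace K - {y})"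
      using assms(2) y by (auto intro!: closedin_Hausdorff_singleton openin_diff)
    then have "openin sorgenfrey_line {x. f x \<in> topspace K - {y}}"
      using openin_continuous_map_preimage[OF cont] by fastforce
    then obtain e where e: "e > 0" "{Inf A..<Inf A + e} \<subseteq> {x. f x \<in> topspace K - {y}}"
      using openin_sorgenfrey_lineD ne range by blast
    obtain t where "t \<in> A" "t < Inf A + e"
      using cInf_lessD[OF A(1), of "Inf A + e"] e(1) by auto
    with lower[of t] e(2) show False
      by (force simp: A_def)
  qed
  ultimately show ?thesis
    using lower by (auto simp: A_def)
qed

theorem corollary3p5:
  fixes K :: "'a topology"
  assumes "compact_space K" and "Hausdorff_space K"
    and "\<exists>f. continuous_map sorgenfrey_line K f \<and> open_map sorgenfrey_line K f
             \<and> f ` topspace sorgenfrey_line = topspace K"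
  shows "metrizable_space K"
proof -
  obtain f where cont: "continuous_map sorgenfrey_line K f" and op: "open_map sorgenfrey_line K f"
    and "range f = topspace K"
    using assms(3) by auto
  then obtain c where c: "f ` {c..} = topspace K"
    using assms(1) compact_open_image_of_ray by blast
  then have "\<forall>y\<in>topspace K. \<exists>t\<ge>c. f t = y \<and> (\<forall>s\<ge>c. f s = y \<longrightarrow> t \<le> s)"
    using least_in_fibre[OF cont assms(2)] by blast
  then obtain m where m: "\<And>y. y \<in> topspace K \<Longrightarrow> c \<le> m y"
    "\<And>y. y \<in> topspace K \<Longrightarrow> f (m y) = y"
    "\<And>y s. y \<in> topspace K \<Longrightarrow> c \<le> s \<Longrightarrow> f s = y \<Longrightarrow> m y \<le> s"
    by metis
  interpret sorgenfrey_section K m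
  proof
    show "openin K {y \<in> topspace K. m y < a}" for a
    proof -
      \<comment> \<open>Minimality of \<open>m y\<close> turns the initial segment into the image of
        a Sorgenfrey-open interval, so openness of \<open>f\<close> applies.\<close>
      have "{y \<in> topspace K. m y < a} = f ` {c..<a}"
      proof (intro equalityI subsetI)
        fix y assume "y \<in> {y \<in> topspace K. m y < a}"
        then show "y \<in> f ` {c..<a}"
          using m(1,2) by (intro image_eqI[of _ _ "m y"]) auto
      next
        fix y assume "y \<in> f ` {c..<a}"
        then obtain s where s: "y = f s" "c \<le> s" "s < a" by auto
        then have "y \<in> topspace K"
          using c by auto
        moreover have "m y < a"
          using m(3)[OF \<open>y \<in> topspace K\<close> s(2) s(1)[symmetric]] s(3) by linarith
        ultimately show "y \<in> {y \<in> topspace K. m y < a}" by blast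
      qed
      then show ?thesis
        using op by (simp add: open_map_def)
    qed
    show "\<exists>e>0. \<forall>y\<in>topspace K. m p \<le> m y \<and> m y < m p + e \<longrightarrow> y \<in> U"
      if U: "openin K U" "p \<in> U" for U p
    proof -
      have "p \<in> topspace K"
        using U openin_subset by blast
      then have "m p \<in> {x. f x \<in> U}"
        using m(2) U by simp
      moreover have "openin sorgenfrey_line {x. f x \<in> U}"
        using openin_continuous_map_preimage[OF cont U(1)] by simp
      \<comment> \<open>If \<open>m y\<close> lies in this interval, then \<open>y = f (m y)\<close>
        is in \<open>U\<close>.\<close>
      ultimately obtain e where "e > 0" "{m p..<m p + e} \<subseteq> {x. f x \<in> U}"
        using openin_sorgenfrey_lineD by blast
      then show ?thesis
        using m(2) by (metis atLeastLessThan_iff mem_Collect_eq subsetD)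
    qed
  qed (fact assms)+
  show ?thesis
    by (rule metrizable)
qed

end
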